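(* Let $\mathcal{A}$ be a complex unital Banach algebra with involution $*$, and let $a,w\in\mathcal{A}$. Then the following are equivalent: (1) $a$ is a generalized $w$-EP element. (2) There exist $x,y\in\mathcal{A}$ such that $a=x+y$, $x^*y=ywx=0$, $x$ is a $w$-EP element, and $yw$ is quasinilpotent.
   Context: An involution is a conjugate-linear map $*$ with $(xy)^*=y^*x^*$ and $x^{**}=x$. An element $u\in\mathcal{A}$ is quasinilpotent if $\lim_{n\to\infty}\|u^n\|^{1/n}=0$. An element $a$ is a $w$-EP element if there exists $x\in\mathcal{A}$ with $a(wx)^2=x$, $x(wa)^2=a$, $(awxw)^*=awxw$, $(xwaw)^*=xwaw$. An element $a$ is a generalized $w$-EP element if there exists $x\in\mathcal{A}$ with $a(wx)^2=x$, $(awxw)^*=awxw$, $(xwaw)^*=xwaw$ and $\lim_{n\to\infty}\|(aw)^n-xw(aw)^{n+1}\|^{1/n}=0$. *)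

theory Defs
  imports "HOL-Analysis.Analysis"
begin

text \<open>
  Complex unital Banach algebras, built on top of the real classes of the library. As usual for
  unital Banach algebras, \<^class>\<open>real_normed_algebra_1\<close> includes the normalisation that the unit
  has norm 1.
\<close>

class scaleC =
  fixes scaleC :: "complex \<Rightarrow> 'a \<Rightarrow> 'a" (infixr \<open>*\<^sub>C\<close> 75)

class complex_banach_algebra_1 = scaleC + real_normed_algebra_1 + banach +
  assumes scaleC_add_right: "c *\<^sub>C (x + y) = c *\<^sub>C x + c *\<^sub>C y"
    and scaleC_add_left: "(c + d) *\<^sub>C x = c *\<^sub>C x + d *\<^sub>C x"
    and scaleC_scaleC: "c *\<^sub>C (d *\<^sub>C x) = (c * d) *\<^sub>C x"
    and scaleC_one: "1 *\<^sub>C x = x"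
    and scaleR_scaleC: "r *\<^sub>R x = complex_of_real r *\<^sub>C x"
    and mult_scaleC_left: "(c *\<^sub>C x) * y = c *\<^sub>C (x * y)"
    and mult_scaleC_right: "x * (c *\<^sub>C y) = c *\<^sub>C (x * y)"
    and norm_scaleC: "norm (c *\<^sub>C x) = cmod c * norm x"

text \<open>No continuity or compatibility with the norm is required of an involution.\<close>

definition involution :: "('a::complex_banach_algebra_1 \<Rightarrow> 'a) \<Rightarrow> bool" where
  "involution star \<longleftrightarrow>
     (\<forall>x y. star (x + y) = star x + star y) \<and>
     (\<forall>c x. star (c *\<^sub>C x) = cnj c *\<^sub>C star x) \<and>
     (\<forall>x y. star (x * y) = star y * star x) \<and>
     (\<forall>x. star (star x) = x)"

definition quasinilpotent :: "'a::complex_banach_algebra_1 \<Rightarrow> bool" where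
  "quasinilpotent u \<longleftrightarrow> (\<lambda>n. root n (norm (u ^ n))) \<longlonglongrightarrow> 0"

definition w_EP :: "('a::complex_banach_algebra_1 \<Rightarrow> 'a) \<Rightarrow> 'a \<Rightarrow> 'a \<Rightarrow> bool" where
  "w_EP star w a \<longleftrightarrow>
     (\<exists>x. a * (w * x)^2 = x \<and> x * (w * a)^2 = a \<and>
          star (a * w * x * w) = a * w * x * w \<and>
          star (x * w * a * w) = x * w * a * w)"

definition generalized_w_EP :: "('a::complex_banach_algebra_1 \<Rightarrow> 'a) \<Rightarrow> 'a \<Rightarrow> 'a \<Rightarrow> bool" where
  "generalized_w_EP star w a \<longleftrightarrow>
     (\<exists>x. a * (w * x)^2 = x \<and>
          star (a * w * x * w) = a * w * x * w \<and>
          star (x * w * a * w) = x * w * a * w \<and>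
          (\<lambda>n. root n (norm ((a * w) ^ n - x * w * (a * w) ^ (n + 1)))) \<longlonglongrightarrow> 0)"

end

theory Submission
  imports Defs
begin

text \<open>
  Put \<open>b = aw\<close> and \<open>c = zw\<close>, where \<open>z\<close> is the witness for \<open>a\<close>. The identity \<open>c = b c\<^sup>2\<close> can be
  iterated to \<open>b\<^sup>n c\<^sup>n c = c\<close>, so multiplying \<open>b\<^sup>n - c b\<^sup>n\<^sup>+\<^sup>1\<close> by powers of \<open>c\<close> on the right turns the
  spectral condition into exact identities such as \<open>c b b c = b c\<close>. Taking adjoints of the
  latter gives \<open>b c = c b\<close>, a self-adjoint idempotent \<open>p\<close> commuting with \<open>b\<close>, and the decomposition
  is \<open>a = p a + (1 - p) a\<close>. Conversely, the witness for the \<open>w\<close>-EP part \<open>x\<close> also serves for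
  \<open>x + y\<close>, because \<open>(1 - p) (aw)\<^sup>n = (yw)\<^sup>n\<close> for \<open>n \<ge> 1\<close>.
\<close>

text \<open>Since \<open>root n (norm (e n * c ^ n))\<close> is at most
  \<open>root n (norm (e n)) * norm c\<close>, it tends to 0. By the root test the series converges,
  so its terms vanish in the limit.\<close>

lemma mult_power_tendsto_zero:
  fixes e :: "nat \<Rightarrow> 'a::{real_normed_algebra_1, banach}"
  assumes "(\<lambda>n. root n (norm (e n))) \<longlonglongrightarrow> 0"
  shows "(\<lambda>n. e n * c ^ n) \<longlonglongrightarrow> 0"
proof -
  have "(\<lambda>n. root n (norm (e n)) * norm c) \<longlonglongrightarrow> 0"
    using tendsto_mult_left_zero[OF assms] .
  \<comment> \<open>Positive \<open>n\<close> only: \<open>root n (norm c ^ n) = norm c\<close> may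
    fail at 0.\<close>
  moreover have "\<forall>\<^sub>F n in sequentially.
      norm (root n (norm (e n * c ^ n))) \<le> root n (norm (e n)) * norm c"
    using eventually_gt_at_top[of 0]
  proof eventually_elim
    case (elim n)
    have "norm (e n * c ^ n) \<le> norm (e n) * norm c ^ n"
      by (meson norm_mult_ineq norm_power_ineq mult_left_mono norm_ge_zero order_trans)
    hence "root n (norm (e n * c ^ n)) \<le> root n (norm (e n) * norm c ^ n)"
      using elim by simp
    thus ?case
      using elim by (simp add: real_root_mult real_root_power_cancel)
  qed
  ultimately have "(\<lambda>n. root n (norm (e n * c ^ n))) \<longlonglongrightarrow> 0"
    by (rule Lim_null_comparison[rotated])
  hence "summable (\<lambda>n. e n * c ^ n)"
    by (rule root_test_convergence) simp
  thus ?thesis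
    by (rule summable_LIMSEQ_zero)
qed

text \<open>Multiplied on the right by \<open>c ^ n * v\<close>, the error term is the constant
  \<open>v - c * b * v\<close>, yet it tends to 0.\<close>

lemma mult_eq_of_power_fixed:
  fixes b c v :: "'a::{real_normed_algebra_1, banach}"
  assumes "(\<lambda>n. root n (norm (b ^ n - c * b ^ (n + 1)))) \<longlonglongrightarrow> 0"
    and fixed: "\<And>n. b ^ n * c ^ n * v = v"
  shows "c * b * v = v"
proof -
  have "(\<lambda>n. (b ^ n - c * b ^ (n + 1)) * c ^ n * v) \<longlonglongrightarrow> 0"
    by (rule tendsto_mult_left_zero[OF mult_power_tendsto_zero[OF assms(1)]])
  moreover have "(b ^ n - c * b ^ (n + 1)) * c ^ n * v = v - c * b * v" for n
  proof -
    have "(b ^ n - c * b ^ (n + 1)) * c ^ n * v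
        = b ^ n * c ^ n * v - c * b * (b ^ n * c ^ n * v)"
      by (simp add: algebra_simps)
    thus ?thesis by (simp only: fixed)
  qed
  ultimately show ?thesis
    by (simp add: LIMSEQ_const_iff)
qed

lemma power_mult_power_fixed:
  fixes b c v :: "'a::monoid_mult"
  assumes "b * c * c = c" and "b * c * v = v"
  shows "b ^ n * c ^ n * v = v"
proof (induction n)
  case (Suc n)
  show ?case
  \<comment> \<open>Contracting \<open>b * c * c\<close> to \<open>c\<close> takes two factors
    \<open>c\<close>, so exponent 1 rests on the second assumption.\<close>
  proof (cases n)
    case 0
    thus ?thesis using assms by simp
  next
    case (Suc m)
    have cn: "c ^ n = c * c ^ m"
      by (simp add: Suc)
    have "b ^ Suc n * c ^ Suc n * v = b ^ n * (b * c * c) * c ^ m * v"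
      by (simp only: power_Suc2[of b n] power_Suc[of c n] cn mult.assoc)
    also have "\<dots> = b ^ n * c ^ n * v"
      unfolding assms(1) by (simp only: cn mult.assoc)
    finally show ?thesis using Suc.IH by simp
  qed
qed simp

text \<open>The adjoint reverses the product of the self-adjoint elements \<open>c * b\<close> and
  \<open>b * c\<close>, and \<open>b * c * c * b\<close> contracts to \<open>c * b\<close>.\<close>

lemma involution_commute:
  assumes "involution star"
    and "star (b * c) = b * c" and "star (c * b) = c * b"
    and "c * b * (b * c) = b * c" and "b * c * c = c"
  shows "c * b = b * c"
proof -
  have "b * c = star (c * b * (b * c))"
    by (simp only: assms(4) assms(2))
  also have "\<dots> = b * c * (c * b)"
    using assms(1-3) by (simp add: involution_def)
  also have "\<dots> = b * c * c * b"
    by (simp only: mult.assoc)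
  finally show ?thesis
    by (simp only: assms(5))
qed

lemma generalized_w_EP_decomposition:
  assumes inv: "involution star" and gen: "generalized_w_EP star w a"
  shows "\<exists>x y. a = x + y \<and> star x * y = 0 \<and> y * w * x = 0 \<and>
           w_EP star w x \<and> quasinilpotent (y * w)"
proof -
  obtain z where z: "a * (w * z)^2 = z"
    and sa1: "star (a * w * z * w) = a * w * z * w"
    and sa2: "star (z * w * a * w) = z * w * a * w"
    and lim: "(\<lambda>n. root n (norm ((a * w) ^ n - z * w * (a * w) ^ (n + 1)))) \<longlonglongrightarrow> 0"
    using gen unfolding generalized_w_EP_def by blast
  define b c where "b = a * w" and "c = z * w"
  have lim: "(\<lambda>n. root n (norm (b ^ n - c * b ^ (n + 1)))) \<longlonglongrightarrow> 0"
    using lim by (simp add: b_def c_def)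
  have bcz: "b * c * z = z"
    using z by (simp add: b_def c_def power2_eq_square mult.assoc)
  hence bcc: "b * c * c = c"
    by (simp add: c_def flip: mult.assoc)
  have cbz: "c * b * z = z"
    by (rule mult_eq_of_power_fixed[OF lim power_mult_power_fixed[OF bcc bcz]])
  hence cbc: "c * b * c = c"
    by (simp add: c_def flip: mult.assoc)
  have cbc': "c * (b * c) = c"
    using cbc by (simp add: mult.assoc)
  hence "b * c * (b * c) = b * c"
    by (simp add: mult.assoc)
  \<comment> \<open>Take \<open>v = b * c\<close>, which is fixed by \<open>b * c\<close> because
    \<open>b * c\<close> is idempotent.\<close>
  hence cbbc: "c * b * (b * c) = b * c"
    by (intro mult_eq_of_power_fixed[OF lim] power_mult_power_fixed[OF bcc])
  have sa1: "star (b * c) = b * c" and sa2: "star (c * b) = c * b"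
    using sa1 sa2 by (simp_all add: b_def c_def mult.assoc)
  have comm: "c * b = b * c"
    by (rule involution_commute[OF inv sa1 sa2 cbbc bcc])
  define p where "p = b * c"
  have pp: "p * p = p" and pb: "p * b = b * p" and cp: "c * p = c" and pz: "p * z = z"
    and bc: "b * c = p" and cb: "c * b = p" and sp: "star p = p"
    using bcz comm sa1 by (simp_all add: p_def cbc' mult.assoc)
  \<comment> \<open>The same rules with a trailing factor, so that they also rewrite inside
    right-nested products.\<close>
  have pp': "p * (p * v) = p * v" and pb': "b * (p * v) = p * (b * v)"
    and cp': "c * (p * v) = c * v" and bc': "b * (c * v) = p * v" and cb': "c * (b * v) = p * v"
    for v
    using pp pb cp bc cb by (simp_all flip: mult.assoc)
  define x y where "x = p * a" and "y = a - p * a"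
  have aw: "a * w = b" "a * (w * v) = b * v" and zw: "z * w = c" "z * (w * v) = c * v" for v
    by (simp_all add: b_def c_def mult.assoc)
  note simps = x_def y_def mult.assoc algebra_simps pp pp' pb' cp cp' bc bc' cb cb' aw zw pz pb[symmetric] sp
  have "star x * y = star a * (p * y)"
    using inv sp by (simp add: x_def involution_def mult.assoc)
  also have "p * y = 0"
    by (simp add: simps)
  finally have orth: "star x * y = 0" by simp
  \<comment> \<open>This is \<open>(1 - p) * b * p * a\<close>, which vanishes because
    \<open>p\<close> commutes with \<open>b\<close>.\<close>
  have ywx: "y * w * x = 0"
    by (simp add: simps)
  \<comment> \<open>The witness \<open>z\<close> of \<open>a\<close> works: as
    \<open>x * w = p * b\<close>, both \<open>x * w * z * w\<close> and \<open>z * w * x * w\<close>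
    equal \<open>p\<close>.\<close>
  have "w_EP star w x"
    unfolding w_EP_def
    by (rule exI[of _ z]) (simp add: simps power2_eq_square)
  moreover have "quasinilpotent (y * w)"
  proof -
    \<comment> \<open>The exponent starts at 1, since exponent 0 would compare 1 with
      \<open>1 - p\<close>. As \<open>c * b = p\<close>, the right side is the error term in
      \<open>lim\<close>.\<close>
    have pow: "(y * w) ^ Suc n = b ^ Suc n - p * b ^ Suc n" for n
    proof (induction n)
      case (Suc n)
      have "(y * w) ^ Suc (Suc n) = (b - p * b) * (b ^ Suc n - p * b ^ Suc n)"
        using Suc by (simp add: y_def aw left_diff_distrib mult.assoc)
      thus ?case by (simp add: simps)
    qed (simp add: y_def b_def algebra_simps)
    have "\<forall>\<^sub>F n in sequentially. root n (norm (b ^ n - c * b ^ (n + 1))) = root n (norm ((y * w) ^ n))"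
      using eventually_gt_at_top[of 0]
    proof eventually_elim
      case (elim n)
      then obtain m where "n = Suc m" using gr0_implies_Suc by blast
      thus ?case using pow[of m] by (simp add: cb')
    qed
    thus ?thesis
      unfolding quasinilpotent_def using lim by (rule Lim_transform_eventually[rotated])
  qed
  ultimately show ?thesis
    using orth ywx by (intro exI[of _ x] exI[of _ y]) (simp add: x_def y_def)
qed

lemma decomposition_generalized_w_EP:
  assumes inv: "involution star" and orth: "star x * y = 0" and ywx: "y * w * x = 0"
    and EP: "w_EP star w x" and qn: "quasinilpotent (y * w)"
  shows "generalized_w_EP star w (x + y)"
proof -
  obtain u where u: "x * (w * u)^2 = u" and x: "u * (w * x)^2 = x"
    and sa1: "star (x * w * u * w) = x * w * u * w"
    and sa2: "star (u * w * x * w) = u * w * x * w"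
    using EP unfolding w_EP_def by blast
  define b c d where "b = x * w" and "c = u * w" and "d = y * w"
  have sa1: "star (b * c) = b * c" and sa2: "star (c * b) = c * b"
    using sa1 sa2 by (simp_all add: b_def c_def mult.assoc)
  have bcu: "b * c * u = u"
    using u by (simp add: b_def c_def power2_eq_square mult.assoc)
  hence bcc: "b * c * c = c"
    by (simp add: c_def flip: mult.assoc)
  have "c * b * x = x"
    using x by (simp add: b_def c_def power2_eq_square mult.assoc)
  hence cbb: "c * b * b = b"
    by (simp add: b_def flip: mult.assoc)
  hence "c * b * (b * c) = b * c"
    by (simp flip: mult.assoc)
  hence comm: "c * b = b * c"
    by (rule involution_commute[OF inv sa1 sa2 _ bcc])
  have db: "d * b = 0"
    using ywx by (simp add: b_def d_def flip: mult.assoc)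
  \<comment> \<open>\<open>u = b * c * u\<close> has \<open>b\<close> as its left factor, which
    \<open>d\<close> annihilates.\<close>
  have du: "d * u = 0"
    using db bcu by (metis mult.assoc mult_zero_left)
  hence dc: "d * c = 0"
    by (simp add: c_def flip: mult.assoc)
  \<comment> \<open>The orthogonality of \<open>x\<close> and \<open>y\<close> enters here:
    self-adjointness turns \<open>b * c\<close> into \<open>star c * star b\<close>.\<close>
  have "star b * d = star w * (star x * y) * w"
    using inv by (simp add: b_def d_def involution_def mult.assoc)
  hence "star b * d = 0"
    using orth by simp
  moreover have "b * c * d = star c * (star b * d)"
    using inv sa1 by (metis involution_def mult.assoc)
  ultimately have pd: "b * c * d = 0" by simp
  \<comment> \<open>Commutation turns \<open>b * c * c = c\<close> into
    \<open>c * b * c = c\<close>.\<close>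
  moreover have "c * d = c * (b * c * d)"
    using bcc comm by (simp flip: mult.assoc)
  ultimately have cd: "c * d = 0" by simp
  have aw: "(x + y) * w = b + d"
    by (simp add: b_def d_def distrib_right)
  have "(x + y) * (w * u)^2 = b * c * u + d * u * (w * u)"
    by (simp add: b_def c_def d_def power2_eq_square algebra_simps)
  hence w1: "(x + y) * (w * u)^2 = u"
    using bcu du by simp
  have w2: "(x + y) * w * u * w = b * c"
  proof -
    have "(x + y) * w * u * w = (b + d) * c"
      by (simp only: c_def mult.assoc flip: aw)
    thus ?thesis using dc by (simp add: distrib_right)
  qed
  have w3: "u * w * (x + y) * w = c * b"
  proof -
    have "u * w * (x + y) * w = c * (b + d)"
      by (simp only: c_def mult.assoc flip: aw)
    thus ?thesis using cd by (simp add: distrib_left)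
  qed
  \<comment> \<open>The leftmost factor absorbs the correction:
    \<open>(1 - c * (b + d)) * (b + d) = d\<close>. Then \<open>d * b = 0\<close> removes
    \<open>b\<close> from each remaining factor.\<close>
  have pow: "(b + d) ^ Suc n - c * (b + d) ^ (Suc n + 1) = d ^ Suc n" for n
  proof -
    have dn: "d * (b + d) ^ n = d ^ Suc n"
    proof (induction n)
      case (Suc n)
      have "d * (b + d) ^ Suc n = (d * b + d * d) * (b + d) ^ n"
        by (simp add: distrib_left mult.assoc distrib_right)
      also have "\<dots> = d * (d * (b + d) ^ n)"
        by (simp add: db mult.assoc)
      finally show ?case using Suc by simp
    qed simp
    have "(b + d) ^ Suc n - c * (b + d) ^ (Suc n + 1)
        = (b + d - (c * b + c * d) * (b + d)) * (b + d) ^ n"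
      by (simp add: algebra_simps)
    also have "b + d - (c * b + c * d) * (b + d) = d"
      using cd cbb pd comm by (simp add: distrib_left)
    finally show ?thesis using dn by simp
  qed
  have "\<forall>\<^sub>F n in sequentially.
      root n (norm (d ^ n)) = root n (norm ((b + d) ^ n - c * (b + d) ^ (n + 1)))"
    using eventually_gt_at_top[of 0]
  proof eventually_elim
    case (elim n)
    then obtain m where "n = Suc m" using gr0_implies_Suc by blast
    thus ?case using pow[of m] by simp
  qed
  moreover have "(\<lambda>n. root n (norm (d ^ n))) \<longlonglongrightarrow> 0"
    using qn by (simp add: quasinilpotent_def d_def)
  ultimately have "(\<lambda>n. root n (norm ((b + d) ^ n - c * (b + d) ^ (n + 1)))) \<longlonglongrightarrow> 0"
    by (rule Lim_transform_eventually[rotated])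
  hence "(\<lambda>n. root n (norm (((x + y) * w) ^ n - u * w * ((x + y) * w) ^ (n + 1)))) \<longlonglongrightarrow> 0"
    by (simp only: aw c_def)
  thus ?thesis
    unfolding generalized_w_EP_def using w1 w2 w3 sa1 sa2 by (intro exI[of _ u]) simp
qed

theorem theorem3p1:
  fixes star :: "'a::complex_banach_algebra_1 \<Rightarrow> 'a" and a w :: 'a
  assumes "involution star"
  shows "generalized_w_EP star w a \<longleftrightarrow>
    (\<exists>x y. a = x + y \<and> star x * y = 0 \<and> y * w * x = 0 \<and>
           w_EP star w x \<and> quasinilpotent (y * w))"
  using generalized_w_EP_decomposition[OF assms] decomposition_generalized_w_EP[OF assms] by blast

end
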